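(* Let $(X,\tau)$ and $(Y,\sigma)$ be topological spaces and let $f \colon (X,\tau) \rightarrow (Y,\sigma)$ be a function. The following conditions are equivalent: (1) $f$ is $RC$-continuous. (2) $f$ is $\beta$-continuous and contra-continuous.
   Context: No separation axioms are assumed and functions are not assumed continuous. For a subset $A$ of a topological space, $\mathrm{Int}(A)$ and $\mathrm{Cl}(A)$ denote interior and closure. $A$ is regular closed if $A = \mathrm{Cl}(\mathrm{Int}(A))$; $\beta$-open if $A \subseteq \mathrm{Cl}(\mathrm{Int}(\mathrm{Cl}(A)))$. A function $f \colon (X,\tau)\to(Y,\sigma)$ is $RC$-continuous (resp. $\beta$-continuous, contra-continuous) if the preimage of every open subset of $Y$ is regular closed (resp. $\beta$-open, closed) in $X$. *)

theory Defs
  imports "HOL-Analysis.Abstract_Topology"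
begin

(* The next two properties imply A \<subseteq> topspace X, since a closure in X lies in topspace X. *)

definition regular_closedin :: "'a topology \<Rightarrow> 'a set \<Rightarrow> bool" where
  "regular_closedin X A \<longleftrightarrow> A = X closure_of (X interior_of A)"

definition beta_openin :: "'a topology \<Rightarrow> 'a set \<Rightarrow> bool" where
  "beta_openin X A \<longleftrightarrow> A \<subseteq> X closure_of (X interior_of (X closure_of A))"

(* The continuity notions below concern functions from topspace X to topspace Y.  That f is such
   a function is not part of the definitions; it is a separate hypothesis where they are used. *)

definition RC_continuous :: "'a topology \<Rightarrow> 'b topology \<Rightarrow> ('a \<Rightarrow> 'b) \<Rightarrow> bool" where
  "RC_continuous X Y f \<longleftrightarrow>
     (\<forall>V. openin Y V \<longrightarrow> regular_closedin X {x \<in> topspace X. f x \<in> V})"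

definition beta_continuous :: "'a topology \<Rightarrow> 'b topology \<Rightarrow> ('a \<Rightarrow> 'b) \<Rightarrow> bool" where
  "beta_continuous X Y f \<longleftrightarrow>
     (\<forall>V. openin Y V \<longrightarrow> beta_openin X {x \<in> topspace X. f x \<in> V})"

definition contra_continuous :: "'a topology \<Rightarrow> 'b topology \<Rightarrow> ('a \<Rightarrow> 'b) \<Rightarrow> bool" where
  "contra_continuous X Y f \<longleftrightarrow>
     (\<forall>V. openin Y V \<longrightarrow> closedin X {x \<in> topspace X. f x \<in> V})"

end

theory Submission
  imports Defs
begin

text \<open>Each kind of continuity tests the preimages of open sets one at a time, so the claim
  reduces to a fact about a single set \<open>A\<close>. If \<open>A\<close> is closed, then Cl(A) =
  A, and beta-openness collapses to A \<subseteq> Cl(Int(A)), one half of regular closedness; the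
  other half holds for every closed set.\<close>

lemma regular_closedin_iff_beta_openin_closedin:
  "regular_closedin X A \<longleftrightarrow> beta_openin X A \<and> closedin X A"
proof
  assume A: "regular_closedin X A"
  then have "closedin X A"
    unfolding regular_closedin_def by (metis closedin_closure_of)
  with A show "beta_openin X A \<and> closedin X A"
    by (simp add: regular_closedin_def beta_openin_def closure_of_closedin)
next
  assume A: "beta_openin X A \<and> closedin X A"
  then have "A \<subseteq> X closure_of (X interior_of A)"
    by (auto simp: beta_openin_def closure_of_closedin)
  \<comment> \<open>\<open>A\<close> is a closed set containing Int(A), hence contains its
    closure.\<close>
  moreover have "X closure_of (X interior_of A) \<subseteq> A"
    using A by (simp add: closure_of_minimal interior_of_subset)
  ultimately show "regular_closedin X A"
    unfolding regular_closedin_def by (rule subset_antisym)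
qed

theorem theorem3p11:
  fixes X :: "'a topology" and Y :: "'b topology" and f :: "'a \<Rightarrow> 'b"
  assumes "f \<in> topspace X \<rightarrow> topspace Y"
  shows "RC_continuous X Y f \<longleftrightarrow> beta_continuous X Y f \<and> contra_continuous X Y f"
  unfolding RC_continuous_def beta_continuous_def contra_continuous_def
    regular_closedin_iff_beta_openin_closedin
  \<comment> \<open>What remains is that \<forall>V distributes over the conjunction.\<close>
  by blast

end
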